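(* There is a one-to-one correspondence between strict $2$-term bihom-$A_\infty$-algebras and crossed modules of bihom-associative algebras.
   Context: All vector spaces and linear maps are over a field $\mathbb{K}$ of characteristic zero. A bihom-$A_\infty$-algebra $(A,m_k,\alpha,\beta)$ is a graded vector space $A=\bigoplus A_i$ with linear maps $m_k:A^{\otimes k}\to A$ of degree $k-2$ for $1\le k<\infty$, and two commuting linear maps $\alpha,\beta:A\to A$ of degree $0$ with $\alpha\circ m_k=m_k\circ\alpha^{\otimes k}$ and $\beta\circ m_k=m_k\circ\beta^{\otimes k}$ for all $k$, such that for all $n\ge1$ and homogeneous $a_i\in A_{|a_i|}$, $$\sum_{i+j=n+1}\sum_{\lambda=1}^{j}(-1)^{\lambda(i+1)+i(|a_1|+\dots+|a_{\lambda-1}|)}m_j\big(\alpha^{i-1}a_1,\dots,\alpha^{i-1}a_{\lambda-1},m_i(a_\lambda,\dots,a_{\lambda+i-1}),\beta^{i-1}a_{\lambda+i},\dots,\beta^{i-1}a_n\big)=0.$$ It is $2$-term if $A=A_0\oplus A_1$ is concentrated in degrees $0,1$; then $m_k=0$ for $k>3$, and one writes it as $(A_1\xrightarrow{d}A_0,m_2,m_3,\alpha_0,\beta_0,\alpha_1,\beta_1)$ with $d=m_1$ and $\alpha_i,\beta_i$ the components of $\alpha,\beta$ on $A_i$. It is strict if $m_3=0$. A bihom-associative algebra $(B,m_B,\alpha_B,\beta_B)$ is a vector space $B$ with a bilinear map $m_B:B\times B\to B$ and two commuting linear maps $\alpha_B,\beta_B:B\to B$, both multiplicative for $m_B$, such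 that $m_B(\alpha_B(a),m_B(b,c))=m_B(m_B(a,b),\beta_B(c))$. A morphism is a linear map commuting with products and with the respective structure maps. A $B$-bimodule $(M,\cdot,\alpha_M,\beta_M)$ is a vector space $M$ with bilinear actions $b\cdot x$ and $x\cdot b$ ($b\in B$, $x\in M$) and commuting linear maps $\alpha_M,\beta_M:M\to M$ such that $\alpha_M(b\cdot x)=\alpha_B(b)\cdot\alpha_M(x)$, $\beta_M(b\cdot x)=\beta_B(b)\cdot\beta_M(x)$, $\alpha_M(x\cdot b)=\alpha_M(x)\cdot\alpha_B(b)$, $\beta_M(x\cdot b)=\beta_M(x)\cdot\beta_B(b)$, $\alpha_B(a)\cdot(b\cdot x)=m_B(a,b)\cdot\beta_M(x)$, $\alpha_M(x)\cdot m_B(a,b)=(x\cdot a)\cdot\beta_B(b)$, $\alpha_B(a)\cdot(x\cdot b)=(a\cdot x)\cdot\beta_B(b)$. A crossed module of bihom-associative algebras is a quadruple $((A,m_A,\alpha_A,\beta_A),(B,m_B,\alpha_B,\beta_B),dt,\phi)$ where $A,B$ are bihom-associative algebras, $dt:A\to B$ is a bihom-associative algebra morphism, and $\phi:B\otimes A\to A$, $\phi:A\otimes B\to A$ define a $B$-bimodule structure on $A$ with respect to $\alpha_A,\beta_A$, such that for $m,n\in A$, $b\in B$: $dt(\phi(b,m))=m_B(b,dt(m))$; $dt(\phi(m,b))=m_B(dt(m),b)$; $\phi(dt(m),n)=m_A(m,n)$; $\phi(m,dt(n))=m_A(m,n)$; $\phi(\alpha_B(b),m_A(m,n))=m_A(\phi(b,m),\beta_A(n))$;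 $\phi(m_A(m,n),\beta_B(b))=m_A(\alpha_A(m),\phi(n,b))$. *)

theory Defs
  imports "HOL.Vector_Spaces" "HOL-Library.FuncSet"
begin

text \<open>
  All vector spaces are subspaces of one ambient vector space, given by the library locale
  \<^locale>\<open>vector_space\<close>; any two vector spaces over the same field embed into a common one.
  Every structure map is required to be \<^const>\<open>extensional\<close>, i.e. to have the value
  \<^const>\<open>undefined\<close> outside its domain, so that equality of records is equality of
  mathematical structures.
\<close>

text \<open>
  A graded vector space \<open>A = \<Oplus> A\<^sub>i\<close> is the family of its components, so that a
  homogeneous element is a pair of a degree \<open>i\<close> and a vector of \<open>A\<^sub>i\<close> (distinct components may
  overlap as subsets of the ambient space, the direct sum being external). A linear map
  \<open>m\<^sub>k\<close> of degree \<open>k - 2\<close> on the \<open>k\<close>-fold tensor power is given by its values on \<open>k\<close>-tuples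
  of homogeneous elements; \<open>ainf_m\<close> collects all \<open>m\<^sub>k\<close> for \<open>k \<ge> 1\<close>, the index \<open>k\<close> being
  the length of the argument list.
\<close>

record 'v ainf =
  ainf_comp :: "int \<Rightarrow> 'v set"
  ainf_m :: "(int \<times> 'v) list \<Rightarrow> 'v"
  ainf_alpha :: "int \<Rightarrow> 'v \<Rightarrow> 'v"
  ainf_beta :: "int \<Rightarrow> 'v \<Rightarrow> 'v"

definition homog :: "'v ainf \<Rightarrow> (int \<times> 'v) set" where
  "homog A = {(i, x). x \<in> ainf_comp A i}"

definition deg :: "(int \<times> 'v) list \<Rightarrow> int" where
  "deg xs = sum_list (map fst xs)"

definition out_deg :: "(int \<times> 'v) list \<Rightarrow> int" where
  "out_deg xs = deg xs + int (length xs) - 2"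

definition hom_m :: "'v ainf \<Rightarrow> (int \<times> 'v) list \<Rightarrow> int \<times> 'v" where
  "hom_m A xs = (out_deg xs, ainf_m A xs)"

definition hom_alpha :: "'v ainf \<Rightarrow> int \<times> 'v \<Rightarrow> int \<times> 'v" where
  "hom_alpha A = (\<lambda>(i, x). (i, ainf_alpha A i x))"

definition hom_beta :: "'v ainf \<Rightarrow> int \<times> 'v \<Rightarrow> int \<times> 'v" where
  "hom_beta A = (\<lambda>(i, x). (i, ainf_beta A i x))"

record 'v bihom_alg =
  alg_space :: "'v set"
  alg_mult :: "'v \<times> 'v \<Rightarrow> 'v"
  alg_alpha :: "'v \<Rightarrow> 'v"
  alg_beta :: "'v \<Rightarrow> 'v"

record 'v crossed_mod =
  cm_A :: "'v bihom_alg"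
  cm_B :: "'v bihom_alg"
  cm_dt :: "'v \<Rightarrow> 'v"
  cm_left :: "'v \<times> 'v \<Rightarrow> 'v"   \<comment> \<open>\<open>\<phi> : B \<otimes> A \<rightarrow> A\<close>\<close>
  cm_right :: "'v \<times> 'v \<Rightarrow> 'v"  \<comment> \<open>\<open>\<phi> : A \<otimes> B \<rightarrow> A\<close>\<close>

context vector_space
begin

definition linear_betw :: "'b set \<Rightarrow> 'b set \<Rightarrow> ('b \<Rightarrow> 'b) \<Rightarrow> bool" where
  "linear_betw V W f \<longleftrightarrow>
     f \<in> V \<rightarrow> W \<and>
     (\<forall>x\<in>V. \<forall>y\<in>V. f (x + y) = f x + f y) \<and>
     (\<forall>c. \<forall>x\<in>V. f (c *s x) = c *s f x)"

definition lin_map :: "'b set \<Rightarrow> 'b set \<Rightarrow> ('b \<Rightarrow> 'b) \<Rightarrow> bool" where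
  "lin_map V W f \<longleftrightarrow> f \<in> extensional V \<and> linear_betw V W f"

definition bilin_map :: "'b set \<Rightarrow> 'b set \<Rightarrow> 'b set \<Rightarrow> ('b \<times> 'b \<Rightarrow> 'b) \<Rightarrow> bool" where
  "bilin_map V W U f \<longleftrightarrow>
     f \<in> extensional (V \<times> W) \<and>
     (\<forall>x\<in>V. linear_betw W U (\<lambda>y. f (x, y))) \<and>
     (\<forall>y\<in>W. linear_betw V U (\<lambda>x. f (x, y)))"

definition stasheff_sum :: "'b ainf \<Rightarrow> (int \<times> 'b) list \<Rightarrow> 'b" where
  "stasheff_sum A as =
     (\<Sum>(i, j) | 1 \<le> i \<and> 1 \<le> j \<and> i + j = length as + 1. \<Sum>l = 1..j.
        ((-1) powi (int l * (int i + 1) + int i * deg (take (l - 1) as))) *s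
        ainf_m A
          (map (hom_alpha A ^^ (i - 1)) (take (l - 1) as)
           @ [hom_m A (take i (drop (l - 1) as))]
           @ map (hom_beta A ^^ (i - 1)) (drop (l - 1 + i) as)))"

definition bihom_ainf_algebra :: "'b ainf \<Rightarrow> bool" where
  "bihom_ainf_algebra A \<longleftrightarrow>
     (\<forall>i. subspace (ainf_comp A i)) \<and>
     ainf_m A \<in> extensional {as. as \<noteq> [] \<and> set as \<subseteq> homog A} \<and>
     (\<forall>us vs i. set us \<subseteq> homog A \<longrightarrow> set vs \<subseteq> homog A \<longrightarrow>
        linear_betw (ainf_comp A i) (ainf_comp A (out_deg (us @ [(i, 0)] @ vs)))
          (\<lambda>x. ainf_m A (us @ [(i, x)] @ vs))) \<and>
     (\<forall>i. lin_map (ainf_comp A i) (ainf_comp A i) (ainf_alpha A i)) \<and>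
     (\<forall>i. lin_map (ainf_comp A i) (ainf_comp A i) (ainf_beta A i)) \<and>
     (\<forall>i. \<forall>x\<in>ainf_comp A i.
        ainf_alpha A i (ainf_beta A i x) = ainf_beta A i (ainf_alpha A i x)) \<and>
     (\<forall>as. as \<noteq> [] \<longrightarrow> set as \<subseteq> homog A \<longrightarrow>
        ainf_alpha A (out_deg as) (ainf_m A as) = ainf_m A (map (hom_alpha A) as)) \<and>
     (\<forall>as. as \<noteq> [] \<longrightarrow> set as \<subseteq> homog A \<longrightarrow>
        ainf_beta A (out_deg as) (ainf_m A as) = ainf_m A (map (hom_beta A) as)) \<and>
     (\<forall>as. as \<noteq> [] \<longrightarrow> set as \<subseteq> homog A \<longrightarrow> stasheff_sum A as = 0)"

definition two_term :: "'b ainf \<Rightarrow> bool" where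
  "two_term A \<longleftrightarrow> (\<forall>i. i \<noteq> 0 \<and> i \<noteq> 1 \<longrightarrow> ainf_comp A i = {0})"

definition strict :: "'b ainf \<Rightarrow> bool" where
  "strict A \<longleftrightarrow> (\<forall>as. length as = 3 \<longrightarrow> set as \<subseteq> homog A \<longrightarrow> ainf_m A as = 0)"

definition strict_two_term_algebra :: "'b ainf \<Rightarrow> bool" where
  "strict_two_term_algebra A \<longleftrightarrow> bihom_ainf_algebra A \<and> two_term A \<and> strict A"

definition bihom_assoc_algebra :: "'b bihom_alg \<Rightarrow> bool" where
  "bihom_assoc_algebra B \<longleftrightarrow>
     (let V = alg_space B; m = alg_mult B; \<alpha> = alg_alpha B; \<beta> = alg_beta B in
      subspace V \<and> bilin_map V V V m \<and> lin_map V V \<alpha> \<and> lin_map V V \<beta> \<and>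
      (\<forall>a\<in>V. \<alpha> (\<beta> a) = \<beta> (\<alpha> a)) \<and>
      (\<forall>a\<in>V. \<forall>b\<in>V. \<alpha> (m (a, b)) = m (\<alpha> a, \<alpha> b)) \<and>
      (\<forall>a\<in>V. \<forall>b\<in>V. \<beta> (m (a, b)) = m (\<beta> a, \<beta> b)) \<and>
      (\<forall>a\<in>V. \<forall>b\<in>V. \<forall>c\<in>V. m (\<alpha> a, m (b, c)) = m (m (a, b), \<beta> c)))"

definition bihom_alg_morphism :: "'b bihom_alg \<Rightarrow> 'b bihom_alg \<Rightarrow> ('b \<Rightarrow> 'b) \<Rightarrow> bool" where
  "bihom_alg_morphism A B f \<longleftrightarrow>
     lin_map (alg_space A) (alg_space B) f \<and>
     (\<forall>x\<in>alg_space A. \<forall>y\<in>alg_space A. f (alg_mult A (x, y)) = alg_mult B (f x, f y)) \<and>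
     (\<forall>x\<in>alg_space A. f (alg_alpha A x) = alg_alpha B (f x)) \<and>
     (\<forall>x\<in>alg_space A. f (alg_beta A x) = alg_beta B (f x))"

definition bihom_bimodule ::
  "'b bihom_alg \<Rightarrow> 'b set \<Rightarrow> ('b \<times> 'b \<Rightarrow> 'b) \<Rightarrow> ('b \<times> 'b \<Rightarrow> 'b) \<Rightarrow>
   ('b \<Rightarrow> 'b) \<Rightarrow> ('b \<Rightarrow> 'b) \<Rightarrow> bool" where
  "bihom_bimodule B M l r \<alpha>\<^sub>M \<beta>\<^sub>M \<longleftrightarrow>
     (let V = alg_space B; m = alg_mult B; \<alpha> = alg_alpha B; \<beta> = alg_beta B in
      subspace M \<and> bilin_map V M M l \<and> bilin_map M V M r \<and>
      lin_map M M \<alpha>\<^sub>M \<and> lin_map M M \<beta>\<^sub>M \<and>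
      (\<forall>x\<in>M. \<alpha>\<^sub>M (\<beta>\<^sub>M x) = \<beta>\<^sub>M (\<alpha>\<^sub>M x)) \<and>
      (\<forall>b\<in>V. \<forall>x\<in>M. \<alpha>\<^sub>M (l (b, x)) = l (\<alpha> b, \<alpha>\<^sub>M x)) \<and>
      (\<forall>b\<in>V. \<forall>x\<in>M. \<beta>\<^sub>M (l (b, x)) = l (\<beta> b, \<beta>\<^sub>M x)) \<and>
      (\<forall>x\<in>M. \<forall>b\<in>V. \<alpha>\<^sub>M (r (x, b)) = r (\<alpha>\<^sub>M x, \<alpha> b)) \<and>
      (\<forall>x\<in>M. \<forall>b\<in>V. \<beta>\<^sub>M (r (x, b)) = r (\<beta>\<^sub>M x, \<beta> b)) \<and>
      (\<forall>a\<in>V. \<forall>b\<in>V. \<forall>x\<in>M. l (\<alpha> a, l (b, x)) = l (m (a, b), \<beta>\<^sub>M x)) \<and>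
      (\<forall>x\<in>M. \<forall>a\<in>V. \<forall>b\<in>V. r (\<alpha>\<^sub>M x, m (a, b)) = r (r (x, a), \<beta> b)) \<and>
      (\<forall>a\<in>V. \<forall>x\<in>M. \<forall>b\<in>V. l (\<alpha> a, r (x, b)) = r (l (a, x), \<beta> b)))"

definition crossed_module :: "'b crossed_mod \<Rightarrow> bool" where
  "crossed_module X \<longleftrightarrow>
     (let A = cm_A X; B = cm_B X; V = alg_space A; W = alg_space B;
          mA = alg_mult A; mB = alg_mult B; dt = cm_dt X; l = cm_left X; r = cm_right X in
      bihom_assoc_algebra A \<and> bihom_assoc_algebra B \<and>
      bihom_alg_morphism A B dt \<and>
      bihom_bimodule B V l r (alg_alpha A) (alg_beta A) \<and>
      (\<forall>b\<in>W. \<forall>m\<in>V. dt (l (b, m)) = mB (b, dt m)) \<and>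
      (\<forall>m\<in>V. \<forall>b\<in>W. dt (r (m, b)) = mB (dt m, b)) \<and>
      (\<forall>m\<in>V. \<forall>n\<in>V. l (dt m, n) = mA (m, n)) \<and>
      (\<forall>m\<in>V. \<forall>n\<in>V. r (m, dt n) = mA (m, n)) \<and>
      (\<forall>b\<in>W. \<forall>m\<in>V. \<forall>n\<in>V. l (alg_alpha B b, mA (m, n)) = mA (l (b, m), alg_beta A n)) \<and>
      (\<forall>m\<in>V. \<forall>n\<in>V. \<forall>b\<in>W. r (mA (m, n), alg_beta B b) = mA (alg_alpha A m, r (n, b))))"

end

text \<open>
  The correspondence takes \<open>B = A\<^sub>0\<close> and \<open>A = A\<^sub>1\<close> with the differential as \<open>dt\<close>, the
  components of \<open>m\<^sub>2\<close> as the product of \<open>B\<close> and the two actions, and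
  \<open>m\<^sub>A(m, n) = m\<^sub>2(d m, n)\<close>, which also equals \<open>m\<^sub>2(m, d n)\<close> for a 2-term algebra.
\<close>

definition crossed_module_of :: "'v ainf \<Rightarrow> 'v crossed_mod" where
  "crossed_module_of A =
     (let V0 = ainf_comp A 0; V1 = ainf_comp A 1; d = (\<lambda>x. ainf_m A [(1, x)]) in
      \<lparr> cm_A = \<lparr> alg_space = V1,
                 alg_mult = restrict (\<lambda>(m, n). ainf_m A [(0, d m), (1, n)]) (V1 \<times> V1),
                 alg_alpha = ainf_alpha A 1, alg_beta = ainf_beta A 1 \<rparr>,
        cm_B = \<lparr> alg_space = V0,
                 alg_mult = restrict (\<lambda>(a, b). ainf_m A [(0, a), (0, b)]) (V0 \<times> V0),
                 alg_alpha = ainf_alpha A 0, alg_beta = ainf_beta A 0 \<rparr>,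
        cm_dt = restrict d V1,
        cm_left = restrict (\<lambda>(b, m). ainf_m A [(0, b), (1, m)]) (V0 \<times> V1),
        cm_right = restrict (\<lambda>(m, b). ainf_m A [(1, m), (0, b)]) (V1 \<times> V0) \<rparr>)"

end

theory Submission imports Defs begin

text \<open>
  A strict 2-term bihom-\<open>A\<^sub>\<infinity>\<close>-algebra and a crossed module carry the same data. For
  degree reasons the only structure maps that can be nonzero are the differential
  \<open>d : A\<^sub>1 \<rightarrow> A\<^sub>0\<close> and the three components \<open>A\<^sub>0 \<otimes> A\<^sub>0 \<rightarrow> A\<^sub>0\<close>, \<open>A\<^sub>0 \<otimes> A\<^sub>1 \<rightarrow> A\<^sub>1\<close>,
  \<open>A\<^sub>1 \<otimes> A\<^sub>0 \<rightarrow> A\<^sub>1\<close> of \<open>m\<^sub>2\<close>: a map \<open>m\<^sub>k\<close> has degree \<open>k - 2\<close>, so for \<open>k \<ge> 4\<close> it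
  leaves the degrees 0 and 1, and \<open>m\<^sub>3\<close> is zero by strictness. The product of \<open>A\<^sub>1\<close> in the
  crossed module is no further datum, being \<open>m\<^sub>2(d m, n)\<close>.

  The same degree count reduces the infinite family of Stasheff identities to two
  (\<open>strict_two_term_algebra_iff\<close>). The identity for two inputs is the Leibniz rule for \<open>d\<close>; on
  \<open>A\<^sub>0 \<times> A\<^sub>1\<close> and \<open>A\<^sub>1 \<times> A\<^sub>0\<close> it says that \<open>d\<close> is equivariant, and on \<open>A\<^sub>1 \<times> A\<^sub>1\<close>, where
  the product vanishes, it is the Peiffer identity \<open>m\<^sub>2(d m, n) = m\<^sub>2(m, d n)\<close>. The identity for
  three inputs is bihom-associativity of \<open>m\<^sub>2\<close>: on \<open>A\<^sub>0\<close> alone it is bihom-associativity of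
  the base algebra, and with exactly one entry in \<open>A\<^sub>1\<close> it gives the three bimodule axioms. The
  remaining axioms of a crossed module, which involve the product of \<open>A\<^sub>1\<close>, follow from these
  by moving \<open>d\<close> inside (\<open>crossed_module_crossed_module_of\<close>). Compatibility with \<open>\<alpha>\<close>
  and \<open>\<beta>\<close> is on both sides the statement that these commute with \<open>d\<close> and \<open>m\<^sub>2\<close>.

  Conversely, the data of a crossed module are the components of an algebra
  (\<open>ainf_of\<close>), the crossed module axioms give the Leibniz rule and associativity in degrees 0 and
  1, and in every other degree both sides vanish. The two constructions are mutually inverse
  (\<open>crossed_module_of_ainf_of\<close>, \<open>ainf_of_crossed_module_of\<close>).
\<close>

context vector_space
begin

section \<open>Structure maps and degree reasons for vanishing\<close>

text \<open>
  Everything that a bihom-\<open>A\<^sub>\<infinity>\<close>-algebra requires except the Stasheff identities, so that these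
  can be studied, and later verified, with the degree and multilinearity arguments at hand.
\<close>

definition bihom_multilinear :: "'b ainf \<Rightarrow> bool" where
  "bihom_multilinear A \<longleftrightarrow>
     (\<forall>i. subspace (ainf_comp A i)) \<and>
     ainf_m A \<in> extensional {as. as \<noteq> [] \<and> set as \<subseteq> homog A} \<and>
     (\<forall>us vs i. set us \<subseteq> homog A \<longrightarrow> set vs \<subseteq> homog A \<longrightarrow>
        linear_betw (ainf_comp A i) (ainf_comp A (out_deg (us @ [(i, 0)] @ vs)))
          (\<lambda>x. ainf_m A (us @ [(i, x)] @ vs))) \<and>
     (\<forall>i. lin_map (ainf_comp A i) (ainf_comp A i) (ainf_alpha A i)) \<and>
     (\<forall>i. lin_map (ainf_comp A i) (ainf_comp A i) (ainf_beta A i)) \<and>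
     (\<forall>i. \<forall>x\<in>ainf_comp A i.
        ainf_alpha A i (ainf_beta A i x) = ainf_beta A i (ainf_alpha A i x)) \<and>
     (\<forall>as. as \<noteq> [] \<longrightarrow> set as \<subseteq> homog A \<longrightarrow>
        ainf_alpha A (out_deg as) (ainf_m A as) = ainf_m A (map (hom_alpha A) as)) \<and>
     (\<forall>as. as \<noteq> [] \<longrightarrow> set as \<subseteq> homog A \<longrightarrow>
        ainf_beta A (out_deg as) (ainf_m A as) = ainf_m A (map (hom_beta A) as))"

lemma bihom_ainf_algebra_iff:
  "bihom_ainf_algebra A \<longleftrightarrow>
     bihom_multilinear A \<and> (\<forall>as. as \<noteq> [] \<longrightarrow> set as \<subseteq> homog A \<longrightarrow> stasheff_sum A as = 0)"
  unfolding bihom_ainf_algebra_def bihom_multilinear_def by (simp only: conj_assoc)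

lemma linear_betw_zero:
  assumes "linear_betw V W f" "subspace V"
  shows "f 0 = 0"
proof -
  have "0 \<in> V" using assms(2) by (rule subspace_0)
  then have "f (0 *s 0) = 0 *s f 0" using assms(1) unfolding linear_betw_def by blast
  then show ?thesis by simp
qed

lemma linear_betw_into: "linear_betw V W f \<Longrightarrow> x \<in> V \<Longrightarrow> f x \<in> W"
  unfolding linear_betw_def by blast

lemma lin_map_into: "lin_map V W f \<Longrightarrow> x \<in> V \<Longrightarrow> f x \<in> W"
  unfolding lin_map_def linear_betw_def by blast

lemma lin_map_zero: "lin_map V W f \<Longrightarrow> subspace V \<Longrightarrow> f 0 = 0"
  unfolding lin_map_def using linear_betw_zero by blast

lemma out_deg_middle: "out_deg (us @ [(i, 0)] @ vs) = out_deg (us @ [(i, x)] @ vs)"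
  by (simp add: out_deg_def deg_def)

lemma bihom_multilinearD:
  assumes "bihom_multilinear A"
  shows "subspace (ainf_comp A i)"
    and "ainf_m A \<in> extensional {as. as \<noteq> [] \<and> set as \<subseteq> homog A}"
    and "set us \<subseteq> homog A \<Longrightarrow> set vs \<subseteq> homog A \<Longrightarrow>
        linear_betw (ainf_comp A i) (ainf_comp A (out_deg (us @ [(i, 0)] @ vs)))
          (\<lambda>x. ainf_m A (us @ [(i, x)] @ vs))"
    and "lin_map (ainf_comp A i) (ainf_comp A i) (ainf_alpha A i)"
    and "lin_map (ainf_comp A i) (ainf_comp A i) (ainf_beta A i)"
    and "x \<in> ainf_comp A i \<Longrightarrow>
        ainf_alpha A i (ainf_beta A i x) = ainf_beta A i (ainf_alpha A i x)"
    and "as \<noteq> [] \<Longrightarrow> set as \<subseteq> homog A \<Longrightarrow>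
        ainf_alpha A (out_deg as) (ainf_m A as) = ainf_m A (map (hom_alpha A) as)"
    and "as \<noteq> [] \<Longrightarrow> set as \<subseteq> homog A \<Longrightarrow>
        ainf_beta A (out_deg as) (ainf_m A as) = ainf_m A (map (hom_beta A) as)"
  using assms unfolding bihom_multilinear_def by simp_all

lemma hom_m_in_homog:
  assumes "bihom_multilinear A" "as \<noteq> []" "set as \<subseteq> homog A"
  shows "hom_m A as \<in> homog A"
proof -
  obtain i x vs where as: "as = [] @ [(i, x)] @ vs"
    using assms(2) by (metis append_Cons append_Nil list.exhaust surj_pair)
  have x: "x \<in> ainf_comp A i" and vs: "set vs \<subseteq> homog A"
    using assms(3) as by (simp_all add: homog_def)
  have "ainf_m A as \<in> ainf_comp A (out_deg ([] @ [(i, 0)] @ vs))"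
    unfolding as
    by (rule linear_betw_into[OF bihom_multilinearD(3)[OF assms(1) _ vs] x]) simp
  also have "out_deg ([] @ [(i, 0)] @ vs) = out_deg as"
    unfolding as by (rule out_deg_middle)
  finally show ?thesis by (simp add: hom_m_def homog_def)
qed

lemma m_zero_entry:
  assumes "bihom_multilinear A" "set as \<subseteq> homog A" "(i, 0) \<in> set as"
  shows "ainf_m A as = 0"
proof -
  obtain us vs where as: "as = us @ [(i, 0)] @ vs" using split_list[OF assms(3)] by auto
  have "set us \<subseteq> homog A" "set vs \<subseteq> homog A" using assms(2) as by auto
  then show ?thesis
    unfolding as
    by (rule linear_betw_zero[OF bihom_multilinearD(3)[OF assms(1)] bihom_multilinearD(1)[OF assms(1)]])
qed

lemma m_zero_out_deg:
  assumes "bihom_multilinear A" "two_term A" "as \<noteq> []" "set as \<subseteq> homog A"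
    and "out_deg as \<notin> {0, 1}"
  shows "ainf_m A as = 0"
  using hom_m_in_homog[OF assms(1,3,4)] assms(2,5)
  unfolding two_term_def hom_m_def homog_def by auto

lemma m_zero_in_deg:
  assumes "bihom_multilinear A" "two_term A" "set as \<subseteq> homog A"
    and "a \<in> set as" "fst a \<notin> {0, 1}"
  shows "ainf_m A as = 0"
proof (rule m_zero_entry[OF assms(1,3)])
  show "(fst a, 0) \<in> set as"
    using assms(2-5) unfolding two_term_def homog_def by (cases a) auto
qed

text \<open>
  With entries in degrees 0 and 1, the value on \<open>k \<ge> 4\<close> entries has degree at least \<open>k - 2 \<ge> 2\<close>
  and so is zero; arity 3 is the strictness assumption. An entry in another degree is zero.
\<close>

lemma m_zero_length:
  assumes "bihom_multilinear A" "two_term A" "strict A" "set as \<subseteq> homog A" "3 \<le> length as"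
  shows "ainf_m A as = 0"
proof (cases "length as = 3 \<or> (\<exists>a\<in>set as. fst a \<notin> {0, 1})")
  case True
  then show ?thesis
    using assms m_zero_in_deg unfolding strict_def by blast
next
  case False
  then have "0 \<le> deg as" unfolding deg_def by (force intro!: sum_list_nonneg)
  then have "out_deg as \<notin> {0, 1}" using False assms(5) by (simp add: out_deg_def)
  then show ?thesis using assms by (intro m_zero_out_deg) auto
qed

lemma hom_alpha_in_homog: "bihom_multilinear A \<Longrightarrow> a \<in> homog A \<Longrightarrow> hom_alpha A a \<in> homog A"
  unfolding hom_alpha_def homog_def by (auto intro: lin_map_into bihom_multilinearD(4))

lemma hom_beta_in_homog: "bihom_multilinear A \<Longrightarrow> a \<in> homog A \<Longrightarrow> hom_beta A a \<in> homog A"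
  unfolding hom_beta_def homog_def by (auto intro: lin_map_into bihom_multilinearD(5))

section \<open>The Stasheff identities of a strict 2-term algebra\<close>

lemma stasheff_sum_singleton:
  "stasheff_sum A [a] = ainf_m A [hom_m A [a]]"
proof -
  have "{(i, j). 1 \<le> i \<and> 1 \<le> j \<and> i + j = length [a] + 1} = {(1::nat, 1::nat)}" by auto
  then show ?thesis unfolding stasheff_sum_def by (simp add: deg_def)
qed

lemma stasheff_sum_pair:
  "stasheff_sum A [a, b] =
     ainf_m A [hom_m A [a], b] + (-1) powi (fst a) *s ainf_m A [a, hom_m A [b]]
     - ainf_m A [hom_m A [a, b]]"
proof -
  have "{(i, j). 1 \<le> i \<and> 1 \<le> j \<and> i + j = length [a, b] + 1} = {(1::nat, 2::nat), (2, 1)}"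
    by auto
  moreover have "{1..2::nat} = {1, 2}" by auto
  ultimately show ?thesis
    unfolding stasheff_sum_def by (simp add: deg_def power_int_add)
qed

text \<open>
  If \<open>i + j \<ge> 4\<close> and not \<open>i = j = 2\<close>, then \<open>i \<ge> 3\<close> or \<open>j \<ge> 3\<close>. In a strict 2-term algebra
  the outer map \<open>m\<^sub>j\<close> vanishes in the latter case, and in the former the inner value \<open>m\<^sub>i\<close> is a
  zero entry of the outer one.
\<close>

lemma stasheff_sum_vanishing:
  assumes "bihom_multilinear A" "two_term A" "strict A" "set as \<subseteq> homog A" "3 \<le> length as"
    and ij: "1 \<le> i" "1 \<le> j" "i + j = length as + 1" "(i, j) \<noteq> (2, 2)" and l: "l \<in> {1..j}"
  shows "ainf_m A
          (map (hom_alpha A ^^ (i - 1)) (take (l - 1) as)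
           @ [hom_m A (take i (drop (l - 1) as))]
           @ map (hom_beta A ^^ (i - 1)) (drop (l - 1 + i) as)) = 0"
    (is "ainf_m A ?os = 0")
proof -
  have pow: "(hom_alpha A ^^ k) a \<in> homog A" "(hom_beta A ^^ k) a \<in> homog A"
    if "a \<in> homog A" for a k
    using that assms(1) by (induction k) (auto intro: hom_alpha_in_homog hom_beta_in_homog)
  have sub: "set (take (l - 1) as) \<subseteq> homog A" "set (drop (l - 1 + i) as) \<subseteq> homog A"
      "set (take i (drop (l - 1) as)) \<subseteq> homog A"
    using assms(4) by (meson order_trans set_take_subset set_drop_subset)+
  have len: "length (take i (drop (l - 1) as)) = i" using ij l by auto
  then have "take i (drop (l - 1) as) \<noteq> []" using ij(1) by auto
  then have os: "set ?os \<subseteq> homog A"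
    using sub pow hom_m_in_homog[OF assms(1)] by auto
  show ?thesis
  proof (cases "3 \<le> j")
    case True
    have "length ?os = j" using ij l by auto
    then show ?thesis using True assms os by (intro m_zero_length) auto
  next
    case False
    then have "3 \<le> i" using ij assms(5) by auto
    then have "ainf_m A (take i (drop (l - 1) as)) = 0"
      using m_zero_length[OF assms(1-3) sub(3)] len by simp
    then have "(out_deg (take i (drop (l - 1) as)), 0) \<in> set ?os"
      by (simp add: hom_m_def)
    then show ?thesis using m_zero_entry[OF assms(1) os] by blast
  qed
qed

lemma stasheff_sum_long:
  assumes "bihom_multilinear A" "two_term A" "strict A" "set as \<subseteq> homog A" "3 \<le> length as"
  shows "stasheff_sum A as =
     (\<Sum>(i, j) | (i, j) = (2, 2) \<and> length as = 3. \<Sum>l = 1..j.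
        ((-1) powi (int l * (int i + 1) + int i * deg (take (l - 1) as))) *s
        ainf_m A
          (map (hom_alpha A ^^ (i - 1)) (take (l - 1) as)
           @ [hom_m A (take i (drop (l - 1) as))]
           @ map (hom_beta A ^^ (i - 1)) (drop (l - 1 + i) as)))"
  unfolding stasheff_sum_def
proof (rule sum.mono_neutral_right, goal_cases)
  case 1
  have "{(i, j). 1 \<le> i \<and> 1 \<le> j \<and> i + j = length as + 1} \<subseteq> {..length as} \<times> {..length as}"
    by auto
  then show ?case by (rule finite_subset) auto
next
  case 2
  then show ?case by auto
next
  case 3
  show ?case
  proof
    fix p
    assume p: "p \<in> {(i, j). 1 \<le> i \<and> 1 \<le> j \<and> i + j = length as + 1}
        - {(i, j). (i, j) = (2, 2) \<and> length as = 3}"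
    obtain i j where ij: "p = (i, j)" by (cases p)
    have "1 \<le> i" "1 \<le> j" "i + j = length as + 1" "(i, j) \<noteq> (2, 2)"
      using p unfolding ij by auto
    note vanish = stasheff_sum_vanishing[OF assms this]
    show "(case p of (i, j) \<Rightarrow> \<Sum>l = 1..j.
        ((-1) powi (int l * (int i + 1) + int i * deg (take (l - 1) as))) *s
        ainf_m A
          (map (hom_alpha A ^^ (i - 1)) (take (l - 1) as)
           @ [hom_m A (take i (drop (l - 1) as))]
           @ map (hom_beta A ^^ (i - 1)) (drop (l - 1 + i) as))) = 0"
      unfolding ij prod.case by (intro sum.neutral ballI) (simp only: vanish scale_zero_right)
  qed
qed

lemma stasheff_sum_triple:
  assumes "bihom_multilinear A" "two_term A" "strict A" "set [a, b, c] \<subseteq> homog A"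
  shows "stasheff_sum A [a, b, c] =
     ainf_m A [hom_alpha A a, hom_m A [b, c]] - ainf_m A [hom_m A [a, b], hom_beta A c]"
proof -
  have "{(i, j). (i, j) = (2, 2) \<and> length [a, b, c] = 3} = {(2::nat, 2::nat)}" by auto
  moreover have "{1..2::nat} = {1, 2}" by auto
  ultimately show ?thesis
    unfolding stasheff_sum_long[OF assms, simplified]
    by (simp add: deg_def power_int_add power_int_mult)
qed

lemma stasheff_sum_ge_4:
  assumes "bihom_multilinear A" "two_term A" "strict A" "set as \<subseteq> homog A" "4 \<le> length as"
  shows "stasheff_sum A as = 0"
  using assms by (subst stasheff_sum_long) auto

text \<open>
  The identity with one input is \<open>d \<circ> d = 0\<close>, which holds because \<open>d \<circ> d\<close> lowers the degree by
  two; from four inputs on every summand vanishes. What remains are the identities with two and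
  three inputs.
\<close>

lemma strict_two_term_algebra_iff:
  "strict_two_term_algebra A \<longleftrightarrow>
     bihom_multilinear A \<and> two_term A \<and> strict A \<and>
     (\<forall>a\<in>homog A. \<forall>b\<in>homog A.
        ainf_m A [hom_m A [a], b] + (-1) powi (fst a) *s ainf_m A [a, hom_m A [b]]
        = ainf_m A [hom_m A [a, b]]) \<and>
     (\<forall>a\<in>homog A. \<forall>b\<in>homog A. \<forall>c\<in>homog A.
        ainf_m A [hom_alpha A a, hom_m A [b, c]] = ainf_m A [hom_m A [a, b], hom_beta A c])"
    (is "?L \<longleftrightarrow> ?ml \<and> ?tt \<and> ?st \<and> ?leib \<and> ?assoc")
proof (cases "?ml \<and> ?tt \<and> ?st")
  case True
  then have ml: ?ml and tt: ?tt and st: ?st by auto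
  have "?L \<longleftrightarrow> (\<forall>as. as \<noteq> [] \<longrightarrow> set as \<subseteq> homog A \<longrightarrow> stasheff_sum A as = 0)"
    using True by (simp add: strict_two_term_algebra_def bihom_ainf_algebra_iff)
  also have "\<dots> \<longleftrightarrow> ?leib \<and> ?assoc"
  proof (intro iffI conjI ballI allI impI)
    assume *: "\<forall>as. as \<noteq> [] \<longrightarrow> set as \<subseteq> homog A \<longrightarrow> stasheff_sum A as = 0"
    fix a b assume ab: "a \<in> homog A" "b \<in> homog A"
    then show "ainf_m A [hom_m A [a], b] + (-1) powi (fst a) *s ainf_m A [a, hom_m A [b]]
        = ainf_m A [hom_m A [a, b]]"
      using *[rule_format, of "[a, b]"] by (simp add: stasheff_sum_pair)
    fix c assume "c \<in> homog A"
    then show "ainf_m A [hom_alpha A a, hom_m A [b, c]] = ainf_m A [hom_m A [a, b], hom_beta A c]"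
      using ab *[rule_format, of "[a, b, c]"] by (simp add: stasheff_sum_triple[OF ml tt st])
  next
    assume *: "?leib \<and> ?assoc"
    fix as assume as: "as \<noteq> []" "set as \<subseteq> homog A"
    consider a where "as = [a]" | a b where "as = [a, b]" | a b c where "as = [a, b, c]"
      | "4 \<le> length as"
    proof -
      have "length as = 1 \<or> length as = 2 \<or> length as = 3 \<or> 4 \<le> length as"
        using as(1)[folded length_greater_0_conv] by linarith
      then show thesis
        by (elim disjE) (use that in \<open>auto simp: numeral_2_eq_2 numeral_3_eq_3 length_Suc_conv\<close>)
    qed
    then show "stasheff_sum A as = 0"
    proof cases
      case (1 a)
      then have a: "a \<in> homog A" using as by simp
      have da: "hom_m A [a] \<in> homog A" using a by (intro hom_m_in_homog[OF ml]) auto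
      have "ainf_m A [hom_m A [a]] = 0"
      proof (cases "fst a \<in> {0, 1}")
        case True
        then show ?thesis using da
          by (intro m_zero_out_deg[OF ml tt]) (auto simp: out_deg_def deg_def hom_m_def)
      next
        case False
        then have "ainf_m A [a] = 0" using a by (intro m_zero_in_deg[OF ml tt, of _ a]) auto
        then show ?thesis using da
          by (intro m_zero_entry[OF ml, of _ "out_deg [a]"]) (auto simp: hom_m_def)
      qed
      then show ?thesis using 1 by (simp add: stasheff_sum_singleton)
    next
      case (2 a b)
      then show ?thesis
        using *[THEN conjunct1, rule_format, of a b] as by (simp add: stasheff_sum_pair)
    next
      case (3 a b c)
      then show ?thesis
        using *[THEN conjunct2, rule_format, of a b c] as
        by (simp add: stasheff_sum_triple[OF ml tt st])
    next
      case 4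
      then show ?thesis using stasheff_sum_ge_4[OF ml tt st as(2)] by blast
    qed
  qed
  finally show ?thesis by (simp only: ml tt st simp_thms)
next
  case False
  show ?thesis
  proof
    assume ?L
    then have "?ml \<and> ?tt \<and> ?st"
      unfolding strict_two_term_algebra_def bihom_ainf_algebra_iff by (elim conjE) (intro conjI)
    with False show "?ml \<and> ?tt \<and> ?st \<and> ?leib \<and> ?assoc" by (rule notE)
  next
    assume "?ml \<and> ?tt \<and> ?st \<and> ?leib \<and> ?assoc"
    then have "?ml \<and> ?tt \<and> ?st" by (elim conjE) (intro conjI)
    with False show ?L by (rule notE)
  qed
qed

section \<open>From a strict 2-term algebra to a crossed module\<close>

lemma linear_betw_cong:
  assumes "linear_betw V W f" "subspace V" "\<And>x. x \<in> V \<Longrightarrow> g x = f x"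
  shows "linear_betw V W g"
  using assms(1) subspace_add[OF assms(2)] subspace_scale[OF assms(2)]
  unfolding linear_betw_def by (simp add: assms(3) Pi_iff)

lemma lin_map_restrict:
  "linear_betw V W f \<Longrightarrow> subspace V \<Longrightarrow> lin_map V W (restrict f V)"
  unfolding lin_map_def by (auto intro: linear_betw_cong)

lemma bilin_map_restrict:
  assumes "subspace V" "subspace W"
    and "\<And>x. x \<in> V \<Longrightarrow> linear_betw W U (f x)"
    and "\<And>y. y \<in> W \<Longrightarrow> linear_betw V U (\<lambda>x. f x y)"
  shows "bilin_map V W U (restrict (\<lambda>(x, y). f x y) (V \<times> W))"
  unfolding bilin_map_def
proof (intro conjI ballI)
  fix x assume "x \<in> V"
  then show "linear_betw W U (\<lambda>y. restrict (\<lambda>(x, y). f x y) (V \<times> W) (x, y))"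
    using assms(3)[of x] by (auto intro: linear_betw_cong[OF _ assms(2)])
next
  fix y assume "y \<in> W"
  then show "linear_betw V U (\<lambda>x. restrict (\<lambda>(x, y). f x y) (V \<times> W) (x, y))"
    using assms(4)[of y] by (auto intro: linear_betw_cong[OF _ assms(1)])
qed auto

lemma linear_betw_const_zero: "subspace W \<Longrightarrow> linear_betw V W (\<lambda>x. 0)"
  unfolding linear_betw_def by (auto simp: subspace_0)

lemma bilin_map_linear:
  assumes "bilin_map V W U f"
  shows "x \<in> V \<Longrightarrow> linear_betw W U (\<lambda>y. f (x, y))"
    and "y \<in> W \<Longrightarrow> linear_betw V U (\<lambda>x. f (x, y))"
  using assms unfolding bilin_map_def by blast+

lemma bilin_map_zero:
  assumes "bilin_map V W U f"
  shows "subspace W \<Longrightarrow> x \<in> V \<Longrightarrow> f (x, 0) = 0" "subspace V \<Longrightarrow> y \<in> W \<Longrightarrow> f (0, y) = 0"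
  using assms linear_betw_zero[of W U "\<lambda>y. f (x, y)"] linear_betw_zero[of V U "\<lambda>x. f (x, y)"]
  unfolding bilin_map_def by blast+

lemma m_unary:
  assumes "bihom_multilinear A"
  shows "linear_betw (ainf_comp A i) (ainf_comp A (i - 1)) (\<lambda>x. ainf_m A [(i, x)])"
    and "x \<in> ainf_comp A i \<Longrightarrow>
      ainf_alpha A (i - 1) (ainf_m A [(i, x)]) = ainf_m A [(i, ainf_alpha A i x)]"
    and "x \<in> ainf_comp A i \<Longrightarrow>
      ainf_beta A (i - 1) (ainf_m A [(i, x)]) = ainf_m A [(i, ainf_beta A i x)]"
  using bihom_multilinearD(3)[OF assms, of "[]" "[]" i]
    bihom_multilinearD(7,8)[OF assms, of "[(i, x)]"]
  by (simp_all add: out_deg_def deg_def homog_def hom_alpha_def hom_beta_def)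

lemma m_binary:
  assumes "bihom_multilinear A"
  shows "x \<in> ainf_comp A i \<Longrightarrow>
      linear_betw (ainf_comp A j) (ainf_comp A (i + j)) (\<lambda>y. ainf_m A [(i, x), (j, y)])"
    and "y \<in> ainf_comp A j \<Longrightarrow>
      linear_betw (ainf_comp A i) (ainf_comp A (i + j)) (\<lambda>x. ainf_m A [(i, x), (j, y)])"
    and "x \<in> ainf_comp A i \<Longrightarrow> y \<in> ainf_comp A j \<Longrightarrow>
      ainf_alpha A (i + j) (ainf_m A [(i, x), (j, y)])
      = ainf_m A [(i, ainf_alpha A i x), (j, ainf_alpha A j y)]"
    and "x \<in> ainf_comp A i \<Longrightarrow> y \<in> ainf_comp A j \<Longrightarrow>
      ainf_beta A (i + j) (ainf_m A [(i, x), (j, y)])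
      = ainf_m A [(i, ainf_beta A i x), (j, ainf_beta A j y)]"
  using bihom_multilinearD(3)[OF assms, of "[(i, x)]" "[]" j]
    bihom_multilinearD(3)[OF assms, of "[]" "[(j, y)]" i]
    bihom_multilinearD(7,8)[OF assms, of "[(i, x), (j, y)]"]
  by (simp_all add: out_deg_def deg_def homog_def hom_alpha_def hom_beta_def)

text \<open>
  Besides the direct instances of the Leibniz rule and of associativity, the axioms involving the
  product \<open>m n = m\<^sub>2(d m, n)\<close> of \<open>A\<^sub>1\<close> use that \<open>d\<close> commutes with \<open>\<alpha>\<close> and with the actions.
  For example \<open>\<alpha>(b) \<cdot> (m n) = m\<^sub>2(m\<^sub>2(b, d m), \<beta> n) = m\<^sub>2(d(b \<cdot> m), \<beta> n) = (b \<cdot> m) \<beta>(n)\<close>.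
\<close>

lemma crossed_module_crossed_module_of:
  assumes "strict_two_term_algebra A"
  shows "crossed_module (crossed_module_of A)"
proof -
  note A = assms[unfolded strict_two_term_algebra_iff]
  have ml: "bihom_multilinear A" and tt: "two_term A" using A by blast+
  \<comment> \<open>In the facts about \<open>\<mu>\<close> below, output degrees are separate variables tied to the input
    degrees by equations, so that they also apply where a degree is a literal 0 or 1.\<close>
  define V where "V = ainf_comp A"
  define \<mu> where "\<mu> = (\<lambda>i j x y. ainf_m A [(i, x), (j, y)])"
  define d where "d = (\<lambda>x. ainf_m A [(1, x)])"
  define \<alpha> where "\<alpha> = ainf_alpha A"
  define \<beta> where "\<beta> = ainf_beta A"
  note defs = V_def \<mu>_def d_def \<alpha>_def \<beta>_def
  have sub: "subspace (V i)" for i unfolding defs by (rule bihom_multilinearD(1)[OF ml])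
  have d_lin: "linear_betw (V 1) (V 0) d"
    and d_\<alpha>: "x \<in> V 1 \<Longrightarrow> \<alpha> 0 (d x) = d (\<alpha> 1 x)"
    and d_\<beta>: "x \<in> V 1 \<Longrightarrow> \<beta> 0 (d x) = d (\<beta> 1 x)" for x
    using m_unary[OF ml, where i = 1] by (simp_all add: defs)
  have \<mu>_lin: "x \<in> V i \<Longrightarrow> k = i + j \<Longrightarrow> linear_betw (V j) (V k) (\<mu> i j x)"
    "y \<in> V j \<Longrightarrow> k = i + j \<Longrightarrow> linear_betw (V i) (V k) (\<lambda>x. \<mu> i j x y)" for i j k x y
    using m_binary(1,2)[OF ml] by (simp_all add: defs)
  have \<mu>_\<alpha>: "x \<in> V i \<Longrightarrow> y \<in> V j \<Longrightarrow> k = i + j \<Longrightarrow> \<alpha> k (\<mu> i j x y) = \<mu> i j (\<alpha> i x) (\<alpha> j y)"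
    and \<mu>_\<beta>: "x \<in> V i \<Longrightarrow> y \<in> V j \<Longrightarrow> k = i + j \<Longrightarrow> \<beta> k (\<mu> i j x y) = \<mu> i j (\<beta> i x) (\<beta> j y)"
    for i j k x y
    using m_binary(3,4)[OF ml] by (simp_all add: defs)
  have \<alpha>: "lin_map (V i) (V i) (\<alpha> i)" and \<beta>: "lin_map (V i) (V i) (\<beta> i)"
    and \<alpha>\<beta>: "x \<in> V i \<Longrightarrow> \<alpha> i (\<beta> i x) = \<beta> i (\<alpha> i x)" for i x
    unfolding defs using bihom_multilinearD(4-6)[OF ml] by auto
  have leib: "ainf_m A [hom_m A [a], b] + (-1) powi (fst a) *s ainf_m A [a, hom_m A [b]]
        = ainf_m A [hom_m A [a, b]]" if "a \<in> homog A" "b \<in> homog A" for a b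
    using A that by blast
  have zero: "ainf_m A as = 0" if "as \<noteq> []" "set as \<subseteq> homog A" "out_deg as \<notin> {0, 1}" for as
    using that m_zero_out_deg[OF ml tt] by blast
  have in0: "hom_m A as \<in> homog A" if "as \<noteq> []" "set as \<subseteq> homog A" for as
    using that hom_m_in_homog[OF ml] by blast
  have d_left: "d (\<mu> 0 1 b x) = \<mu> 0 0 b (d x)"
    and d_right: "d (\<mu> 1 0 x b) = \<mu> 0 0 (d x) b" if "b \<in> V 0" "x \<in> V 1" for b x
  proof -
    have h: "(0, b) \<in> homog A" "(1, x) \<in> homog A" using that by (simp_all add: homog_def defs)
    \<comment> \<open>The summand containing \<open>m\<^sub>1 b\<close> drops out, since \<open>m\<^sub>1 b\<close> has degree \<open>-1\<close>.\<close>
    have "ainf_m A [(0, b)] = 0" using h by (intro zero) (auto simp: out_deg_def deg_def)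
    then have z: "hom_m A [(0, b)] = (-1, 0)" by (simp add: hom_m_def out_deg_def deg_def)
    have mb: "(-1, 0) \<in> homog A" using in0[of "[(0, b)]"] h z by simp
    have "ainf_m A [(-1, 0), (1, x)] = 0" "ainf_m A [(1, x), (-1, 0)] = 0"
      using mb h by (auto intro!: m_zero_entry[OF ml, of _ "-1"])
    with leib[OF h] leib[OF h(2,1)] z show "d (\<mu> 0 1 b x) = \<mu> 0 0 b (d x)"
      "d (\<mu> 1 0 x b) = \<mu> 0 0 (d x) b"
      by (simp_all add: defs hom_m_def out_deg_def deg_def)
  qed
  have peiffer: "\<mu> 0 1 (d x) y = \<mu> 1 0 x (d y)" if "x \<in> V 1" "y \<in> V 1" for x y
  proof -
    have h: "(1, x) \<in> homog A" "(1, y) \<in> homog A" using that by (simp_all add: homog_def defs)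
    have "ainf_m A [hom_m A [(1, x), (1, y)]] = 0"
      using h in0[of "[(1, x), (1, y)]"]
      by (intro m_zero_in_deg[OF ml tt, of _ "hom_m A [(1, x), (1, y)]"])
        (auto simp: out_deg_def deg_def hom_m_def)
    with leib[OF h] show ?thesis by (simp add: defs hom_m_def out_deg_def deg_def)
  qed
  have assoc: "\<mu> i m (\<alpha> i x) (\<mu> j k y z) = \<mu> n k (\<mu> i j x y) (\<beta> k z)"
    if "x \<in> V i" "y \<in> V j" "z \<in> V k" "m = j + k" "n = i + j" for i j k m n x y z
  proof -
    have "(i, x) \<in> homog A" "(j, y) \<in> homog A" "(k, z) \<in> homog A"
      using that by (simp_all add: homog_def defs)
    then have "ainf_m A [hom_alpha A (i, x), hom_m A [(j, y), (k, z)]]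
      = ainf_m A [hom_m A [(i, x), (j, y)], hom_beta A (k, z)]"
      using A by blast
    then show ?thesis using that
      by (simp add: defs hom_m_def out_deg_def deg_def hom_alpha_def hom_beta_def)
  qed
  have closed: "x \<in> V 1 \<Longrightarrow> d x \<in> V 0" "x \<in> V i \<Longrightarrow> \<alpha> i x \<in> V i" "x \<in> V i \<Longrightarrow> \<beta> i x \<in> V i" for i x
    using d_lin \<alpha> \<beta> by (auto intro: linear_betw_into lin_map_into)
  have closed2: "x \<in> V i \<Longrightarrow> y \<in> V j \<Longrightarrow> k = i + j \<Longrightarrow> \<mu> i j x y \<in> V k" for i j k x y
    using \<mu>_lin(1) linear_betw_into by blast
  define mA where "mA = restrict (\<lambda>(m, n). \<mu> 0 1 (d m) n) (V 1 \<times> V 1)"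
  define mB where "mB = restrict (\<lambda>(a, b). \<mu> 0 0 a b) (V 0 \<times> V 0)"
  define l where "l = restrict (\<lambda>(b, m). \<mu> 0 1 b m) (V 0 \<times> V 1)"
  define r where "r = restrict (\<lambda>(m, b). \<mu> 1 0 m b) (V 1 \<times> V 0)"
  have mA: "x \<in> V 1 \<Longrightarrow> y \<in> V 1 \<Longrightarrow> mA (x, y) = \<mu> 0 1 (d x) y"
    and mB: "a \<in> V 0 \<Longrightarrow> b \<in> V 0 \<Longrightarrow> mB (a, b) = \<mu> 0 0 a b"
    and l: "a \<in> V 0 \<Longrightarrow> x \<in> V 1 \<Longrightarrow> l (a, x) = \<mu> 0 1 a x"
    and r: "a \<in> V 0 \<Longrightarrow> x \<in> V 1 \<Longrightarrow> r (x, a) = \<mu> 1 0 x a" for a b x y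
    by (simp_all add: mA_def mB_def l_def r_def)
  have X: "crossed_module_of A =
    \<lparr> cm_A = \<lparr> alg_space = V 1, alg_mult = mA, alg_alpha = \<alpha> 1, alg_beta = \<beta> 1 \<rparr>,
      cm_B = \<lparr> alg_space = V 0, alg_mult = mB, alg_alpha = \<alpha> 0, alg_beta = \<beta> 0 \<rparr>,
      cm_dt = restrict d (V 1), cm_left = l, cm_right = r \<rparr>"
    unfolding crossed_module_of_def Let_def mA_def mB_def l_def r_def defs ..
  have bil: "bilin_map (V 1) (V 1) (V 1) mA" "bilin_map (V 0) (V 0) (V 0) mB"
    "bilin_map (V 0) (V 1) (V 1) l" "bilin_map (V 1) (V 0) (V 1) r"
    unfolding mA_def mB_def l_def r_def
  proof -
    have "linear_betw (V 1) (V 1) (\<lambda>x. \<mu> 0 1 (d x) y)" if "y \<in> V 1" for y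
      using d_lin \<mu>_lin(2)[OF that, of 1 0] unfolding linear_betw_def by (auto simp: Pi_iff)
    then show "bilin_map (V 1) (V 1) (V 1) (restrict (\<lambda>(m, n). \<mu> 0 1 (d m) n) (V 1 \<times> V 1))"
      using closed \<mu>_lin(1)[of _ 0 1 1] by (intro bilin_map_restrict sub) auto
  qed (use \<mu>_lin(1)[of _ 0 0 0] \<mu>_lin(1)[of _ 0 1 1] \<mu>_lin(1)[of _ 1 1 0]
      \<mu>_lin(2)[of _ 0 0 0] \<mu>_lin(2)[of _ 0 1 1] \<mu>_lin(2)[of _ 1 1 0]
      in \<open>auto intro!: bilin_map_restrict sub\<close>)
  have dt: "lin_map (V 1) (V 0) (restrict d (V 1))"
    using d_lin sub by (rule lin_map_restrict)
  note simps = mA mB l r closed closed2 d_\<alpha> d_\<beta> d_left d_right \<mu>_\<alpha> \<mu>_\<beta> \<alpha>\<beta>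
  have "bihom_assoc_algebra (cm_A (crossed_module_of A))"
    unfolding bihom_assoc_algebra_def X Let_def
    using sub bil \<alpha> \<beta> assoc[of _ 0 _ 0 _ 1] by (simp add: simps flip: d_\<alpha>)
  moreover have "bihom_assoc_algebra (cm_B (crossed_module_of A))"
    unfolding bihom_assoc_algebra_def X Let_def
    using sub bil \<alpha> \<beta> assoc[of _ 0 _ 0 _ 0] by (simp add: simps)
  moreover have "bihom_alg_morphism (cm_A (crossed_module_of A)) (cm_B (crossed_module_of A))
      (cm_dt (crossed_module_of A))"
    unfolding bihom_alg_morphism_def X using dt by (simp add: simps)
  moreover have "bihom_bimodule (cm_B (crossed_module_of A)) (V 1) l r (\<alpha> 1) (\<beta> 1)"
    unfolding bihom_bimodule_def X Let_def
    using sub bil \<alpha> \<beta> assoc[of _ 0 _ 0 _ 1] assoc[of _ 1 _ 0 _ 0] assoc[of _ 0 _ 1 _ 0]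
    by (simp add: simps)
  moreover have "\<mu> 0 1 (\<alpha> 0 b) (\<mu> 0 1 (d m) n) = \<mu> 0 1 (d (\<mu> 0 1 b m)) (\<beta> 1 n)"
    and "\<mu> 1 0 (\<mu> 0 1 (d m) n) (\<beta> 0 b) = \<mu> 0 1 (d (\<alpha> 1 m)) (\<mu> 1 0 n b)"
    if "b \<in> V 0" "m \<in> V 1" "n \<in> V 1" for b m n
    using that assoc[of b 0 "d m" 0 n 1 1 0] assoc[of "d m" 0 n 1 b 0 1 1]
    by (simp_all add: closed d_left flip: d_\<alpha>)
  ultimately show ?thesis
    unfolding crossed_module_def Let_def X
    by (simp add: mA mB l r closed closed2 d_left d_right peiffer)
qed

section \<open>From a crossed module to a strict 2-term algebra\<close>

lemma bihom_assoc_algebraD: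
  assumes "bihom_assoc_algebra B"
  shows "subspace (alg_space B)"
    and "bilin_map (alg_space B) (alg_space B) (alg_space B) (alg_mult B)"
    and "lin_map (alg_space B) (alg_space B) (alg_alpha B)"
    and "lin_map (alg_space B) (alg_space B) (alg_beta B)"
    and "a \<in> alg_space B \<Longrightarrow> alg_alpha B (alg_beta B a) = alg_beta B (alg_alpha B a)"
    and "a \<in> alg_space B \<Longrightarrow> b \<in> alg_space B \<Longrightarrow>
      alg_alpha B (alg_mult B (a, b)) = alg_mult B (alg_alpha B a, alg_alpha B b)"
    and "a \<in> alg_space B \<Longrightarrow> b \<in> alg_space B \<Longrightarrow>
      alg_beta B (alg_mult B (a, b)) = alg_mult B (alg_beta B a, alg_beta B b)"
    and "a \<in> alg_space B \<Longrightarrow> b \<in> alg_space B \<Longrightarrow> c \<in> alg_space B \<Longrightarrow>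
      alg_mult B (alg_alpha B a, alg_mult B (b, c)) = alg_mult B (alg_mult B (a, b), alg_beta B c)"
  using assms unfolding bihom_assoc_algebra_def Let_def by simp_all

lemma bihom_bimoduleD:
  assumes "bihom_bimodule B M l r \<alpha> \<beta>"
  shows "bilin_map (alg_space B) M M l" and "bilin_map M (alg_space B) M r"
    and "b \<in> alg_space B \<Longrightarrow> x \<in> M \<Longrightarrow> \<alpha> (l (b, x)) = l (alg_alpha B b, \<alpha> x)"
    and "b \<in> alg_space B \<Longrightarrow> x \<in> M \<Longrightarrow> \<beta> (l (b, x)) = l (alg_beta B b, \<beta> x)"
    and "b \<in> alg_space B \<Longrightarrow> x \<in> M \<Longrightarrow> \<alpha> (r (x, b)) = r (\<alpha> x, alg_alpha B b)"
    and "b \<in> alg_space B \<Longrightarrow> x \<in> M \<Longrightarrow> \<beta> (r (x, b)) = r (\<beta> x, alg_beta B b)"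
    and "a \<in> alg_space B \<Longrightarrow> b \<in> alg_space B \<Longrightarrow> x \<in> M \<Longrightarrow>
      l (alg_alpha B a, l (b, x)) = l (alg_mult B (a, b), \<beta> x)"
    and "a \<in> alg_space B \<Longrightarrow> b \<in> alg_space B \<Longrightarrow> x \<in> M \<Longrightarrow>
      r (\<alpha> x, alg_mult B (a, b)) = r (r (x, a), alg_beta B b)"
    and "a \<in> alg_space B \<Longrightarrow> b \<in> alg_space B \<Longrightarrow> x \<in> M \<Longrightarrow>
      l (alg_alpha B a, r (x, b)) = r (l (a, x), alg_beta B b)"
  using assms unfolding bihom_bimodule_def Let_def by simp_all

lemma bihom_alg_morphismD:
  assumes "bihom_alg_morphism A B f"
  shows "lin_map (alg_space A) (alg_space B) f"
    and "x \<in> alg_space A \<Longrightarrow> f (alg_alpha A x) = alg_alpha B (f x)"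
    and "x \<in> alg_space A \<Longrightarrow> f (alg_beta A x) = alg_beta B (f x)"
  using assms unfolding bihom_alg_morphism_def by simp_all

lemma crossed_moduleD:
  assumes "crossed_module X"
  shows "bihom_assoc_algebra (cm_A X)" and "bihom_assoc_algebra (cm_B X)"
    and "bihom_alg_morphism (cm_A X) (cm_B X) (cm_dt X)"
    and "bihom_bimodule (cm_B X) (alg_space (cm_A X)) (cm_left X) (cm_right X)
      (alg_alpha (cm_A X)) (alg_beta (cm_A X))"
    and "b \<in> alg_space (cm_B X) \<Longrightarrow> m \<in> alg_space (cm_A X) \<Longrightarrow>
      cm_dt X (cm_left X (b, m)) = alg_mult (cm_B X) (b, cm_dt X m)"
    and "b \<in> alg_space (cm_B X) \<Longrightarrow> m \<in> alg_space (cm_A X) \<Longrightarrow>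
      cm_dt X (cm_right X (m, b)) = alg_mult (cm_B X) (cm_dt X m, b)"
    and "m \<in> alg_space (cm_A X) \<Longrightarrow> n \<in> alg_space (cm_A X) \<Longrightarrow>
      cm_left X (cm_dt X m, n) = alg_mult (cm_A X) (m, n)"
    and "m \<in> alg_space (cm_A X) \<Longrightarrow> n \<in> alg_space (cm_A X) \<Longrightarrow>
      cm_right X (m, cm_dt X n) = alg_mult (cm_A X) (m, n)"
  using assms unfolding crossed_module_def Let_def by simp_all
definition cm_comp :: "'b crossed_mod \<Rightarrow> int \<Rightarrow> 'b set" where
  "cm_comp X i = (if i = 0 then alg_space (cm_B X) else if i = 1 then alg_space (cm_A X) else {0})"

fun cm_op :: "'b crossed_mod \<Rightarrow> (int \<times> 'b) list \<Rightarrow> 'b" where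
  "cm_op X [(i, x)] = (if i = 1 then cm_dt X x else 0)"
| "cm_op X [(i, x), (j, y)] =
    (if i = 0 \<and> j = 0 then alg_mult (cm_B X) (x, y)
     else if i = 0 \<and> j = 1 then cm_left X (x, y)
     else if i = 1 \<and> j = 0 then cm_right X (x, y) else 0)"
| "cm_op X as = 0"

text \<open>
  The domain of the structure maps is spelled out instead of using \<^const>\<open>homog\<close>, which takes the
  algebra being defined as its argument; \<open>homog_ainf_of\<close> identifies the two. In the zero components
  \<open>\<alpha>\<close> and \<open>\<beta>\<close> have to be the extensional zero map for the two constructions to be inverse to
  each other.
\<close>

definition ainf_of :: "'b crossed_mod \<Rightarrow> 'b ainf" where
  "ainf_of X =
    \<lparr> ainf_comp = cm_comp X,
      ainf_m = restrict (cm_op X) {as. as \<noteq> [] \<and> (\<forall>(i, x)\<in>set as. x \<in> cm_comp X i)},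
      ainf_alpha = (\<lambda>i. if i = 0 then alg_alpha (cm_B X) else if i = 1 then alg_alpha (cm_A X)
        else restrict (\<lambda>_. 0) {0}),
      ainf_beta = (\<lambda>i. if i = 0 then alg_beta (cm_B X) else if i = 1 then alg_beta (cm_A X)
        else restrict (\<lambda>_. 0) {0}) \<rparr>"

lemma homog_ainf_of: "homog (ainf_of X) = {(i, x). x \<in> cm_comp X i}"
  by (simp add: homog_def ainf_of_def)

lemma m_ainf_of:
  "as \<noteq> [] \<Longrightarrow> set as \<subseteq> homog (ainf_of X) \<Longrightarrow> ainf_m (ainf_of X) as = cm_op X as"
  unfolding homog_ainf_of by (auto simp: ainf_of_def)

lemma alpha_ainf_of:
  "ainf_alpha (ainf_of X) i = (if i = 0 then alg_alpha (cm_B X)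
     else if i = 1 then alg_alpha (cm_A X) else restrict (\<lambda>_. 0) {0})"
  by (simp add: ainf_of_def)

lemma beta_ainf_of:
  "ainf_beta (ainf_of X) i = (if i = 0 then alg_beta (cm_B X)
     else if i = 1 then alg_beta (cm_A X) else restrict (\<lambda>_. 0) {0})"
  by (simp add: ainf_of_def)

lemma cm_op_long: "3 \<le> length as \<Longrightarrow> cm_op X as = 0"
  by (cases "(X, as)" rule: cm_op.cases) auto

lemma out_deg_simps:
  "out_deg [(i, x)] = i - 1" "out_deg [(i, x), (j, y)] = i + j"
  by (simp_all add: out_deg_def deg_def)

lemma subspace_cm_comp: "crossed_module X \<Longrightarrow> subspace (cm_comp X i)"
  by (simp add: cm_comp_def bihom_assoc_algebraD(1) crossed_moduleD(1,2))

lemma cm_op_linear: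
  assumes "crossed_module X"
  shows "linear_betw (cm_comp X i) (cm_comp X (i - 1)) (\<lambda>x. cm_op X [(i, x)])"
    and "y \<in> cm_comp X j \<Longrightarrow>
      linear_betw (cm_comp X i) (cm_comp X (i + j)) (\<lambda>x. cm_op X [(i, x), (j, y)])"
    and "y \<in> cm_comp X j \<Longrightarrow>
      linear_betw (cm_comp X i) (cm_comp X (j + i)) (\<lambda>x. cm_op X [(j, y), (i, x)])"
proof -
  note sub = subspace_cm_comp[OF assms]
  note lin = bihom_alg_morphismD(1)[OF crossed_moduleD(3)[OF assms]]
  note bil = bihom_assoc_algebraD(2)[OF crossed_moduleD(2)[OF assms]]
    bihom_bimoduleD(1,2)[OF crossed_moduleD(4)[OF assms]]
  have zero: "linear_betw (cm_comp X i) (cm_comp X k) f" if "\<And>x. f x = 0" for f i k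
  proof -
    have "f = (\<lambda>_. 0)" using that by (rule ext)
    then show ?thesis using linear_betw_const_zero[OF sub] by simp
  qed
  show "linear_betw (cm_comp X i) (cm_comp X (i - 1)) (\<lambda>x. cm_op X [(i, x)])"
  proof (cases "i = 1")
    case True
    then show ?thesis using lin by (simp add: cm_comp_def lin_map_def)
  qed (auto intro: zero)
  assume y: "y \<in> cm_comp X j"
  show "linear_betw (cm_comp X i) (cm_comp X (i + j)) (\<lambda>x. cm_op X [(i, x), (j, y)])"
  proof (cases "(i, j) \<in> {(0, 0), (0, 1), (1, 0)}")
    case True
    then consider "i = 0" "j = 0" | "i = 0" "j = 1" | "i = 1" "j = 0" by auto
    then show ?thesis
      by cases (use y in \<open>simp_all add: cm_comp_def
        bil[THEN bilin_map_linear(1)] bil[THEN bilin_map_linear(2)]\<close>)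
  qed (auto intro: zero)
  show "linear_betw (cm_comp X i) (cm_comp X (j + i)) (\<lambda>x. cm_op X [(j, y), (i, x)])"
  proof (cases "(i, j) \<in> {(0, 0), (0, 1), (1, 0)}")
    case True
    then consider "i = 0" "j = 0" | "i = 0" "j = 1" | "i = 1" "j = 0" by auto
    then show ?thesis
      by cases (use y in \<open>simp_all add: cm_comp_def
        bil[THEN bilin_map_linear(1)] bil[THEN bilin_map_linear(2)]\<close>)
  qed (auto intro: zero)
qed

lemma bihom_multilinear_ainf_of:
  assumes "crossed_module X"
  shows "bihom_multilinear (ainf_of X)"
  unfolding bihom_multilinear_def
proof (intro conjI allI impI ballI)
  note A = bihom_assoc_algebraD[OF crossed_moduleD(1)[OF assms]]
    and B = bihom_assoc_algebraD[OF crossed_moduleD(2)[OF assms]]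
    and dt = bihom_alg_morphismD[OF crossed_moduleD(3)[OF assms]]
    and act = bihom_bimoduleD[OF crossed_moduleD(4)[OF assms]]
  let ?A = "ainf_of X"
  have comp: "ainf_comp ?A = cm_comp X" by (simp add: ainf_of_def)
  note sub = subspace_cm_comp[OF assms]
  show "subspace (ainf_comp ?A i)" for i by (simp add: comp sub)
  show "ainf_m ?A \<in> extensional {as. as \<noteq> [] \<and> set as \<subseteq> homog ?A}"
    unfolding homog_ainf_of by (auto simp: ainf_of_def extensional_def)
  show lin\<alpha>: "lin_map (ainf_comp ?A i) (ainf_comp ?A i) (ainf_alpha ?A i)" for i
    using A(3,4) B(3,4) linear_betw_const_zero[of "{0}" "{0}"]
    by (simp add: ainf_of_def cm_comp_def lin_map_restrict)
  show lin\<beta>: "lin_map (ainf_comp ?A i) (ainf_comp ?A i) (ainf_beta ?A i)" for i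
    using A(3,4) B(3,4) linear_betw_const_zero[of "{0}" "{0}"]
    by (simp add: ainf_of_def cm_comp_def lin_map_restrict)
  show "ainf_alpha ?A i (ainf_beta ?A i x) = ainf_beta ?A i (ainf_alpha ?A i x)"
    if "x \<in> ainf_comp ?A i" for i x
    using A(5) B(5) that by (simp add: ainf_of_def cm_comp_def split: if_splits)
  show "linear_betw (ainf_comp ?A i) (ainf_comp ?A (out_deg (us @ [(i, 0)] @ vs)))
          (\<lambda>x. ainf_m ?A (us @ [(i, x)] @ vs))"
    if us: "set us \<subseteq> homog ?A" and vs: "set vs \<subseteq> homog ?A" for us vs i
    unfolding comp
  proof (rule linear_betw_cong[OF _ sub])
    show "ainf_m ?A (us @ [(i, x)] @ vs) = cm_op X (us @ [(i, x)] @ vs)"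
      if "x \<in> cm_comp X i" for x
      using us vs that by (intro m_ainf_of) (auto simp: homog_ainf_of)
    consider "us = []" "vs = []" | j y where "us = []" "vs = [(j, y)]"
      | j y where "us = [(j, y)]" "vs = []" | "2 \<le> length us + length vs"
      by (cases us; cases vs; cases "tl us"; cases "tl vs") auto
    then show "linear_betw (cm_comp X i) (cm_comp X (out_deg (us @ [(i, 0)] @ vs)))
          (\<lambda>x. cm_op X (us @ [(i, x)] @ vs))"
    proof cases
      case 4
      then have "(\<lambda>x. cm_op X (us @ [(i, x)] @ vs)) = (\<lambda>x. 0)"
        by (intro ext cm_op_long) auto
      then show ?thesis using linear_betw_const_zero[OF sub] by simp
    qed (use us vs cm_op_linear[OF assms] in
        \<open>auto simp: homog_ainf_of out_deg_simps simp del: cm_op.simps\<close>)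
  qed
  have m_map: "ainf_m ?A (map f as) = cm_op X (map f as)"
    if "as \<noteq> []" "set as \<subseteq> homog ?A" "f \<in> homog ?A \<rightarrow> homog ?A" for f as
    using that by (intro m_ainf_of) auto
  have hom\<alpha>: "hom_alpha ?A \<in> homog ?A \<rightarrow> homog ?A" and hom\<beta>: "hom_beta ?A \<in> homog ?A \<rightarrow> homog ?A"
    using lin\<alpha> lin\<beta> by (auto simp: homog_def hom_alpha_def hom_beta_def intro: lin_map_into)
  have \<alpha>0: "ainf_alpha ?A i 0 = 0" and \<beta>0: "ainf_beta ?A i 0 = 0" for i
    using lin_map_zero[OF lin\<alpha>] lin_map_zero[OF lin\<beta>] by (simp_all add: comp sub)
  fix as assume as: "as \<noteq> []" "set as \<subseteq> homog ?A"
  have entries: "x \<in> cm_comp X i" if "(i, x) \<in> set as" for i x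
    using as(2) that by (auto simp: homog_ainf_of)
  consider i x where "as = [(i, x)]" | i x j y where "as = [(i, x), (j, y)]" | "3 \<le> length as"
    using as(1) by (cases "(X, as)" rule: cm_op.cases) auto
  note shape = this
  have "ainf_alpha ?A (out_deg as) (cm_op X as) = cm_op X (map (hom_alpha ?A) as)"
    using shape
  proof cases
    case (1 i x)
    then show ?thesis
      using entries[of i x]
      by (cases "i = 1")
        (simp_all add: out_deg_simps hom_alpha_def \<alpha>0, simp add: alpha_ainf_of cm_comp_def dt(2))
  next
    case (2 i x j y)
    show ?thesis
    proof (cases "(i, j) \<in> {(0, 0), (0, 1), (1, 0)}")
      case True
      then consider "i = 0" "j = 0" | "i = 0" "j = 1" | "i = 1" "j = 0" by auto
      then show ?thesis
        by cases (use 2 entries[of i x] entries[of j y] in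
          \<open>simp_all add: out_deg_simps hom_alpha_def alpha_ainf_of cm_comp_def B(6) act(3,5)\<close>)
    next
      case False
      then show ?thesis using 2 by (auto simp: hom_alpha_def \<alpha>0)
    qed
  qed (simp add: cm_op_long \<alpha>0)
  then show "ainf_alpha ?A (out_deg as) (ainf_m ?A as) = ainf_m ?A (map (hom_alpha ?A) as)"
    by (simp only: m_ainf_of[OF as] m_map[OF as hom\<alpha>])
  have "ainf_beta ?A (out_deg as) (cm_op X as) = cm_op X (map (hom_beta ?A) as)"
    using shape
  proof cases
    case (1 i x)
    then show ?thesis
      using entries[of i x]
      by (cases "i = 1")
        (simp_all add: out_deg_simps hom_beta_def \<beta>0, simp add: beta_ainf_of cm_comp_def dt(3))
  next
    case (2 i x j y)
    show ?thesis
    proof (cases "(i, j) \<in> {(0, 0), (0, 1), (1, 0)}")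
      case True
      then consider "i = 0" "j = 0" | "i = 0" "j = 1" | "i = 1" "j = 0" by auto
      then show ?thesis
        by cases (use 2 entries[of i x] entries[of j y] in
          \<open>simp_all add: out_deg_simps hom_beta_def beta_ainf_of cm_comp_def B(7) act(4,6)\<close>)
    next
      case False
      then show ?thesis using 2 by (auto simp: hom_beta_def \<beta>0)
    qed
  qed (simp add: cm_op_long \<beta>0)
  then show "ainf_beta ?A (out_deg as) (ainf_m ?A as) = ainf_m ?A (map (hom_beta ?A) as)"
    by (simp only: m_ainf_of[OF as] m_map[OF as hom\<beta>])
qed

text \<open>
  When all degrees are 0 or 1 the Leibniz rule and associativity are crossed module axioms, or else
  both sides lie in a degree other than 0 and 1 and vanish. An entry in another degree is zero and
  makes both sides zero.
\<close>

lemma strict_two_term_algebra_ainf_of: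
  assumes "crossed_module X"
  shows "strict_two_term_algebra (ainf_of X)"
  unfolding strict_two_term_algebra_iff
proof (intro conjI ballI)
  note A = bihom_assoc_algebraD[OF crossed_moduleD(1)[OF assms]]
    and B = bihom_assoc_algebraD[OF crossed_moduleD(2)[OF assms]]
    and dt = bihom_alg_morphismD[OF crossed_moduleD(3)[OF assms]]
    and act = bihom_bimoduleD[OF crossed_moduleD(4)[OF assms]]
    and cm = crossed_moduleD(5-8)[OF assms]
  let ?A = "ainf_of X"
  show ml: "bihom_multilinear ?A" using assms by (rule bihom_multilinear_ainf_of)
  show tt: "two_term ?A" by (simp add: two_term_def ainf_of_def cm_comp_def)
  show "strict ?A"
    unfolding strict_def
  proof (intro allI impI)
    fix as assume "length as = 3" "set as \<subseteq> homog ?A"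
    then show "ainf_m ?A as = 0" by (subst m_ainf_of) (auto intro: cm_op_long)
  qed
  have hom: "hom_m ?A as = (out_deg as, cm_op X as)" and hom_in: "hom_m ?A as \<in> homog ?A"
    if "as \<noteq> []" "set as \<subseteq> homog ?A" for as
    using that hom_m_in_homog[OF ml that] by (simp_all add: hom_m_def m_ainf_of)
  have cl: "v \<in> cm_comp X p \<Longrightarrow> cm_op X [(p, v)] \<in> cm_comp X (p - 1)"
    "v \<in> cm_comp X p \<Longrightarrow> w \<in> cm_comp X q \<Longrightarrow> cm_op X [(p, v), (q, w)] \<in> cm_comp X (p + q)"
    for p q v w
    by (rule linear_betw_into[OF cm_op_linear(1)[OF assms]]
        linear_betw_into[OF cm_op_linear(2)[OF assms]]; assumption)+
  note z0 = lin_map_zero[OF dt(1) A(1)] bilin_map_zero(1)[OF B(2) B(1)] bilin_map_zero(2)[OF B(2) B(1)]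
    bilin_map_zero(1)[OF act(1) A(1)] bilin_map_zero(2)[OF act(1) B(1)]
    bilin_map_zero(1)[OF act(2) B(1)] bilin_map_zero(2)[OF act(2) A(1)]
  have z: "cm_op X [(p, 0)] = 0"
    "w \<in> cm_comp X q \<Longrightarrow> cm_op X [(p, 0), (q, w)] = 0"
    "w \<in> cm_comp X q \<Longrightarrow> cm_op X [(q, w), (p, 0)] = 0" for p q w
    by (rule cm_op_linear[OF assms, THEN linear_betw_zero]; (rule subspace_cm_comp[OF assms])?; assumption?)+
  have out: "v = 0" if "v \<in> cm_comp X p" "p \<noteq> 0" "p \<noteq> 1" for p v
    using that by (simp add: cm_comp_def)
  have comp: "ainf_comp ?A = cm_comp X" by (simp add: ainf_of_def)
  note \<alpha> = bihom_multilinearD(4)[OF ml, unfolded comp]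
    and \<beta> = bihom_multilinearD(5)[OF ml, unfolded comp]
  have hom\<alpha>: "ainf_alpha ?A p v \<in> cm_comp X p" "ainf_alpha ?A p 0 = 0"
    and hom\<beta>: "ainf_beta ?A p v \<in> cm_comp X p" "ainf_beta ?A p 0 = 0"
    if "v \<in> cm_comp X p" for p v
    using lin_map_into[OF \<alpha> that] lin_map_into[OF \<beta> that]
      lin_map_zero[OF \<alpha> subspace_cm_comp[OF assms]] lin_map_zero[OF \<beta> subspace_cm_comp[OF assms]]
    by simp_all
  fix a b assume a: "a \<in> homog ?A" and b: "b \<in> homog ?A"
  obtain i x where ix: "a = (i, x)" by (cases a)
  obtain j y where jy: "b = (j, y)" by (cases b)
  have x: "x \<in> cm_comp X i" and y: "y \<in> cm_comp X j"
    using a b ix jy by (simp_all add: homog_ainf_of)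
  have "cm_op X [(i - 1, cm_op X [(i, x)]), (j, y)]
      + (-1) powi i *s cm_op X [(i, x), (j - 1, cm_op X [(j, y)])]
      = cm_op X [(i + j, cm_op X [(i, x), (j, y)])]"
  proof (cases "i \<in> {0, 1} \<and> j \<in> {0, 1}")
    case True
    then consider "i = 0" "j = 0" | "i = 0" "j = 1" | "i = 1" "j = 0" | "i = 1" "j = 1" by auto
    then show ?thesis
      by cases (use x y in \<open>simp_all add: cm_comp_def cm z0\<close>)
  next
    case False
    then have "x = 0 \<or> y = 0" using out[OF x] out[OF y] by auto
    then show ?thesis
      by (rule disjE) (use x y in \<open>simp_all add: z cl del: cm_op.simps\<close>)
  qed
  then show "ainf_m ?A [hom_m ?A [a], b] + (-1) powi (fst a) *s ainf_m ?A [a, hom_m ?A [b]]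
        = ainf_m ?A [hom_m ?A [a, b]]"
    using a b hom_in[of "[a]"] hom_in[of "[b]"] hom_in[of "[a, b]"]
    by (simp add: m_ainf_of hom out_deg_simps ix jy del: cm_op.simps)
  fix c assume c: "c \<in> homog ?A"
  obtain k w where kw: "c = (k, w)" by (cases c)
  have w: "w \<in> cm_comp X k" using c kw by (simp add: homog_ainf_of)
  have "cm_op X [(i, ainf_alpha ?A i x), (j + k, cm_op X [(j, y), (k, w)])]
      = cm_op X [(i + j, cm_op X [(i, x), (j, y)]), (k, ainf_beta ?A k w)]"
  proof (cases "i \<in> {0, 1} \<and> j \<in> {0, 1} \<and> k \<in> {0, 1}")
    case True
    then have "i = 0 \<or> i = 1" "j = 0 \<or> j = 1" "k = 0 \<or> k = 1" by auto
    then show ?thesis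
      by (elim disjE) (use x y w in
        \<open>simp_all add: cm_comp_def alpha_ainf_of beta_ainf_of act(7-9) B(8)\<close>)
  next
    case False
    then have "x = 0 \<or> y = 0 \<or> w = 0" using out[OF x] out[OF y] out[OF w] by auto
    then show ?thesis
      by (elim disjE) (use x y w in \<open>simp_all add: z cl hom\<alpha> hom\<beta> del: cm_op.simps\<close>)
  qed
  then show "ainf_m ?A [hom_alpha ?A a, hom_m ?A [b, c]] = ainf_m ?A [hom_m ?A [a, b], hom_beta ?A c]"
    using a b c hom_in[of "[a, b]"] hom_in[of "[b, c]"]
      hom_alpha_in_homog[OF ml a] hom_beta_in_homog[OF ml c]
    by (simp add: m_ainf_of hom out_deg_simps ix jy kw hom_alpha_def hom_beta_def del: cm_op.simps)
qed

section \<open>The two constructions are mutually inverse\<close>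

text \<open>
  The product of \<open>A\<close> is recovered from the left action by the crossed module axiom
  \<open>\<phi>(dt(m), n) = m\<^sub>A(m, n)\<close>. All other components are read off directly.
\<close>

lemma crossed_module_of_ainf_of:
  assumes "crossed_module X"
  shows "crossed_module_of (ainf_of X) = X"
proof -
  note A = bihom_assoc_algebraD[OF crossed_moduleD(1)[OF assms]]
    and B = bihom_assoc_algebraD[OF crossed_moduleD(2)[OF assms]]
    and dt = bihom_alg_morphismD[OF crossed_moduleD(3)[OF assms]]
    and act = bihom_bimoduleD[OF crossed_moduleD(4)[OF assms]]
    and cm = crossed_moduleD(5-8)[OF assms]
  have restrict_eq: "restrict f S = g" if "g \<in> extensional S" "\<And>x. x \<in> S \<Longrightarrow> f x = g x"
    for f g :: "'c \<Rightarrow> 'b" and S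
    using that by (intro extensionalityI[of _ S]) auto
  have m1: "ainf_m (ainf_of X) [(1, x)] = cm_dt X x" if "x \<in> alg_space (cm_A X)" for x
    using that by (subst m_ainf_of) (auto simp: homog_ainf_of cm_comp_def)
  have m00: "ainf_m (ainf_of X) [(0, a), (0, b)] = alg_mult (cm_B X) (a, b)"
    if "a \<in> alg_space (cm_B X)" "b \<in> alg_space (cm_B X)" for a b
    using that by (subst m_ainf_of) (auto simp: homog_ainf_of cm_comp_def)
  have m01: "ainf_m (ainf_of X) [(0, b), (1, x)] = cm_left X (b, x)"
    and m10: "ainf_m (ainf_of X) [(1, x), (0, b)] = cm_right X (x, b)"
    if "b \<in> alg_space (cm_B X)" "x \<in> alg_space (cm_A X)" for b x
    using that by (subst m_ainf_of; force simp: homog_ainf_of cm_comp_def)+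
  have comp: "ainf_comp (ainf_of X) 0 = alg_space (cm_B X)"
    "ainf_comp (ainf_of X) 1 = alg_space (cm_A X)"
    by (simp_all add: ainf_of_def cm_comp_def)
  have ext: "dom = V \<times> W \<Longrightarrow> bilin_map V W U f \<Longrightarrow> f \<in> extensional dom" for dom V W U f
    by (simp add: bilin_map_def)
  have "restrict (\<lambda>x. ainf_m (ainf_of X) [(1, x)]) (alg_space (cm_A X)) = cm_dt X"
    using dt(1) by (intro restrict_eq) (simp_all add: lin_map_def m1)
  moreover have "restrict (\<lambda>(m, n). ainf_m (ainf_of X) [(0, ainf_m (ainf_of X) [(1, m)]), (1, n)])
      (alg_space (cm_A X) \<times> alg_space (cm_A X)) = alg_mult (cm_A X)"
    by (intro restrict_eq ext[OF refl A(2)])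
      (auto simp: m1 m01 cm lin_map_into[OF dt(1)])
  moreover have "restrict (\<lambda>(a, b). ainf_m (ainf_of X) [(0, a), (0, b)])
      (alg_space (cm_B X) \<times> alg_space (cm_B X)) = alg_mult (cm_B X)"
    by (intro restrict_eq ext[OF refl B(2)]) (auto simp: m00)
  moreover have "restrict (\<lambda>(b, m). ainf_m (ainf_of X) [(0, b), (1, m)])
      (alg_space (cm_B X) \<times> alg_space (cm_A X)) = cm_left X"
    by (intro restrict_eq ext[OF refl act(1)]) (auto simp: m01)
  moreover have "restrict (\<lambda>(m, b). ainf_m (ainf_of X) [(1, m), (0, b)])
      (alg_space (cm_A X) \<times> alg_space (cm_B X)) = cm_right X"
    by (intro restrict_eq ext[OF refl act(2)]) (auto simp: m10)
  ultimately show ?thesis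
    unfolding crossed_module_of_def Let_def comp
    by (intro crossed_mod.equality bihom_alg.equality) (simp_all add: alpha_ainf_of beta_ainf_of)
qed

text \<open>
  The construction keeps only \<open>d\<close> and three components of \<open>m\<^sub>2\<close>, so the point is that all other
  values of the structure maps of a strict 2-term algebra are zero. Equality as records then follows
  from extensionality, there being only one extensional linear endomorphism of a zero component.
\<close>

lemma ainf_of_crossed_module_of:
  assumes "strict_two_term_algebra A"
  shows "ainf_of (crossed_module_of A) = A"
proof -
  let ?X = "crossed_module_of A"
  note A = assms[unfolded strict_two_term_algebra_iff]
  have ml: "bihom_multilinear A" and tt: "two_term A" and st: "strict A" using A by blast+
  have comp: "cm_comp ?X = ainf_comp A"
  proof
    fix i show "cm_comp ?X i = ainf_comp A i"
      using tt by (simp add: cm_comp_def crossed_module_of_def Let_def two_term_def)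
  qed
  then have H: "homog (ainf_of ?X) = homog A"
    unfolding homog_ainf_of by (simp add: homog_def)
  have X: "cm_dt ?X x = ainf_m A [(1, x)]" if "x \<in> ainf_comp A 1" for x
    using that by (simp add: crossed_module_of_def Let_def)
  have X2: "a \<in> ainf_comp A 0 \<Longrightarrow> b \<in> ainf_comp A 0 \<Longrightarrow>
      alg_mult (cm_B ?X) (a, b) = ainf_m A [(0, a), (0, b)]"
    "a \<in> ainf_comp A 0 \<Longrightarrow> x \<in> ainf_comp A 1 \<Longrightarrow> cm_left ?X (a, x) = ainf_m A [(0, a), (1, x)]"
    "a \<in> ainf_comp A 0 \<Longrightarrow> x \<in> ainf_comp A 1 \<Longrightarrow> cm_right ?X (x, a) = ainf_m A [(1, x), (0, a)]"
    for a b x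
    by (simp_all add: crossed_module_of_def Let_def)
  have op: "cm_op ?X as = ainf_m A as" if as: "as \<noteq> []" "set as \<subseteq> homog A" for as
  proof -
    have zero: "ainf_m A as = 0" if "out_deg as \<notin> {0, 1} \<or> (\<exists>a\<in>set as. fst a \<notin> {0, 1})"
      using that m_zero_out_deg[OF ml tt as] m_zero_in_deg[OF ml tt as(2)] by blast
    consider i x where "as = [(i, x)]" | i x j y where "as = [(i, x), (j, y)]" | "3 \<le> length as"
      using as(1) by (cases "(?X, as)" rule: cm_op.cases) auto
    then show ?thesis
    proof cases
      case (1 i x)
      then have x: "x \<in> ainf_comp A i" using as(2) by (simp add: homog_def)
      show ?thesis
      proof (cases "i = 1")
        case True
        then show ?thesis using 1 x X by simp
      next
        case False
        then have "ainf_m A as = 0" using 1 by (intro zero) (simp add: out_deg_simps, linarith?)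
        then show ?thesis using 1 False by simp
      qed
    next
      case (2 i x j y)
      then have xy: "x \<in> ainf_comp A i" "y \<in> ainf_comp A j" using as(2) by (simp_all add: homog_def)
      show ?thesis
      proof (cases "(i, j) \<in> {(0, 0), (0, 1), (1, 0)}")
        case True
        then consider "i = 0" "j = 0" | "i = 0" "j = 1" | "i = 1" "j = 0" by auto
        then show ?thesis by cases (use 2 xy in \<open>simp_all add: X2\<close>)
      next
        case False
        then have "i \<notin> {0, 1} \<or> j \<notin> {0, 1} \<or> i + j \<notin> {0, 1}" by auto
        then have "ainf_m A as = 0" using 2 by (intro zero) (simp add: out_deg_simps, blast)
        then show ?thesis using 2 False by auto
      qed
    next
      case 3
      then show ?thesis using m_zero_length[OF ml tt st as(2)] by (simp add: cm_op_long)
    qed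
  qed
  have triv: "f = restrict (\<lambda>_. 0) {0}" if "lin_map {0} {0} f" for f :: "'b \<Rightarrow> 'b"
    using that lin_map_zero[OF that]
    by (intro extensionalityI[of _ "{0}"]) (auto simp: lin_map_def)
  have other: "ainf_comp A i = {0}" if "i \<noteq> 0" "i \<noteq> 1" for i
    using tt that by (simp add: two_term_def)
  have "ainf_m (ainf_of ?X) = ainf_m A"
  proof (rule extensionalityI)
    show "ainf_m (ainf_of ?X) \<in> extensional {as. as \<noteq> [] \<and> set as \<subseteq> homog A}"
      unfolding H[symmetric] homog_ainf_of by (auto simp: ainf_of_def extensional_def)
    show "ainf_m A \<in> extensional {as. as \<noteq> [] \<and> set as \<subseteq> homog A}"
      by (rule bihom_multilinearD(2)[OF ml])
    show "ainf_m (ainf_of ?X) as = ainf_m A as"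
      if "as \<in> {as. as \<noteq> [] \<and> set as \<subseteq> homog A}" for as
      using that op by (simp add: m_ainf_of H)
  qed
  moreover have "ainf_alpha (ainf_of ?X) = ainf_alpha A"
  proof
    fix i show "ainf_alpha (ainf_of ?X) i = ainf_alpha A i"
      using triv[of "ainf_alpha A i"] bihom_multilinearD(4)[OF ml, of i] other[of i]
      by (cases "i = 0"; cases "i = 1") (simp_all add: alpha_ainf_of crossed_module_of_def Let_def)
  qed
  moreover have "ainf_beta (ainf_of ?X) = ainf_beta A"
  proof
    fix i show "ainf_beta (ainf_of ?X) i = ainf_beta A i"
      using triv[of "ainf_beta A i"] bihom_multilinearD(5)[OF ml, of i] other[of i]
      by (cases "i = 0"; cases "i = 1") (simp_all add: beta_ainf_of crossed_module_of_def Let_def)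
  qed
  moreover have "ainf_comp (ainf_of ?X) = ainf_comp A"
    by (simp add: ainf_of_def comp)
  ultimately show ?thesis
    by (intro ainf.equality) simp_all
qed

end

theorem theorem6p8:
  fixes scale :: "'k::field_char_0 \<Rightarrow> 'v::ab_group_add \<Rightarrow> 'v"
  assumes "vector_space scale"
  shows "bij_betw crossed_module_of
           {A. vector_space.strict_two_term_algebra scale A}
           {X. vector_space.crossed_module scale X}"
proof -
  interpret vector_space scale by (rule assms)
  show ?thesis
    by (rule bij_betw_byWitness[where f' = ainf_of])
      (auto simp: ainf_of_crossed_module_of crossed_module_of_ainf_of
        crossed_module_crossed_module_of strict_two_term_algebra_ainf_of)
qed

end
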